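(* Let $D^{(+)}=\{z\in\mathbf{C}:\operatorname{Re} z<1\}$ and $D^{(-)}=\{z\in\mathbf{C}:\operatorname{Re} z>0\}$. Put $f_1^{(+)}(z)=\mathrm{Li}_1(z)$. For each integer $k\ge 2$, assume that $f_k^{(+)}$ is a holomorphic function on $D^{(+)}$ and $f_k^{(-)}$ is a holomorphic function on $D^{(-)}$ and that, for every $k\ge 2$, they satisfy: (i) the functional relation $$f_k^{(+)}(z)+\sum_{j=1}^{k-1}\frac{(-1)^j\log^j z}{j!}f_{k-j}^{(+)}(z)+f_k^{(-)}(z)=\zeta(k)\qquad (z\in D^{(+)}\cap D^{(-)});$$ (ii) the asymptotic conditions $$\frac{d}{dz}f_k^{(+)}(z)\to 0\quad (z\to\infty,\ z\in D^{(+)}),\qquad \frac{d}{dz}f_k^{(-)}(z)\to 0\quad (z\to\infty,\ z\in D^{(-)});$$ (iii) the normalization condition $f_k^{(+)}(0)=0$. Then for every $k\ge 2$, $$f_k^{(+)}(z)=\mathrm{Li}_k(z)\quad (z\in D^{(+)}),\qquad f_k^{(-)}(z)=\mathrm{Li}_{2,\underbrace{\scriptstyle 1,\ldots,1}_{k-2}}(1-z)\quad (z\in D^{(-)}).$$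
   Context: Let $D=\mathbf{C}\setminus\{x\in\mathbf{R}: x\ge 1\}$ and $D'=\mathbf{C}\setminus\{x\in\mathbf{R}: x\le 0\}$; note $D^{(+)}\subset D$ and $D^{(-)}\subset D'$. Here $\log z$ denotes the principal value of the logarithm on $D'$ (with $\log 1=0$), and $\log^j z=(\log z)^j$. Polylogarithms (principal values, holomorphic on $D$): $\mathrm{Li}_1(z)=-\log(1-z)$ on $D$, with the branch such that $\mathrm{Li}_1(0)=0$; and recursively, for $k\ge 2$, $$\mathrm{Li}_k(z)=\int_0^z\frac{\mathrm{Li}_{k-1}(t)}{t}\,dt,$$ where the integration contour lies in $D$. (For $|z|<1$ one has $\mathrm{Li}_k(z)=\sum_{n\ge1} z^n/n^k$.) For $k\ge 2$, define for $z\in D$ $$\mathrm{Li}_{2,\underbrace{\scriptstyle 1,\ldots,1}_{k-2}}(z)=\int_0^z\frac{(-1)^{k-1}}{(k-1)!}\frac{\log^{k-1}(1-t)}{t}\,dt,$$ with contour in $D$ and $\log(1-t)$ the principal value. Thus $\mathrm{Li}_{2,1,\ldots,1}(1-z)$ is holomorphic on $D'$, its branch being determined by the principal value of $\log z$. For $k=2$ this is $\mathrm{Li}_2(1-z)$. $\zeta(k)=\sum_{n=1}^\infty n^{-k}$ is the Riemann zeta value. *)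

theory Defs
  imports "HOL-Complex_Analysis.Complex_Analysis"
begin

definition D_plus :: "complex set" where
  "D_plus = {z. Re z < 1}"

definition D_minus :: "complex set" where
  "D_minus = {z. Re z > 0}"

definition D_slit :: "complex set" where
  "D_slit = - {z. z \<in> \<real> \<and> Re z \<ge> 1}"

text \<open>
  The iterated integral, taken along the segment from \<open>0\<close> to \<open>z\<close>, which lies in \<^term>\<open>D_slit\<close>
  whenever \<open>z\<close> does (values for \<open>z\<close> outside \<^term>\<open>D_slit\<close> are irrelevant). The lemma
  \<open>polylog_contour\<close> below shows that every other contour in \<^term>\<open>D_slit\<close> gives the same value.
  The weight-0 clause only makes the function total.
\<close>

fun polylog :: "nat \<Rightarrow> complex \<Rightarrow> complex" where
  "polylog 0 z = z / (1 - z)"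
| "polylog (Suc 0) z = - Ln (1 - z)"
| "polylog (Suc (Suc k)) z = contour_integral (linepath 0 z) (\<lambda>t. polylog (Suc k) t / t)"

text \<open>
  The multiple polylogarithm with index \<open>(2, 1, \<dots>, 1)\<close>; the parameter \<open>k \<ge> 2\<close> is the weight,
  so there are \<open>k - 2\<close> ones.
\<close>

definition polylog_2_ones :: "nat \<Rightarrow> complex \<Rightarrow> complex" where
  "polylog_2_ones k z =
     contour_integral (linepath 0 z)
       (\<lambda>t. (-1) ^ (k - 1) / fact (k - 1) * (Ln (1 - t) ^ (k - 1) / t))"

definition zeta_nat :: "nat \<Rightarrow> complex" where
  "zeta_nat k = (\<Sum>n. 1 / of_nat (Suc n) ^ k)"


subsection \<open>Independence of the contour\<close>

lemma open_D_slit: "open D_slit"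
proof -
  have "{z. z \<in> \<real> \<and> Re z \<ge> 1} = \<real> \<inter> {z. Re z \<ge> 1}" by auto
  moreover have "closed (\<real> \<inter> {z. Re z \<ge> 1})"
    by (intro closed_Int closed_complex_Reals closed_halfspace_Re_ge)
  ultimately show ?thesis unfolding D_slit_def by (metis open_Compl)
qed

lemma one_minus_D_slit: "z \<in> D_slit \<Longrightarrow> 1 - z \<notin> \<real>\<^sub>\<le>\<^sub>0"
  by (auto simp: D_slit_def complex_nonpos_Reals_iff complex_is_Real_iff)

lemma zero_in_D_slit: "0 \<in> D_slit"
  by (simp add: D_slit_def)

lemma segment_D_slit: "z \<in> D_slit \<Longrightarrow> closed_segment 0 z \<subseteq> D_slit"
proof
  fix w assume z: "z \<in> D_slit" and "w \<in> closed_segment 0 z"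
  then obtain u where u: "0 \<le> u" "u \<le> 1" "w = of_real u * z"
    by (auto simp: in_segment scaleR_conv_of_real)
  show "w \<in> D_slit"
  proof (rule ccontr)
    assume "w \<notin> D_slit"
    then have w: "u * Im z = 0" "u * Re z \<ge> 1"
      using u by (auto simp: D_slit_def complex_is_Real_iff)
    then have "u \<noteq> 0" by auto
    then have "u > 0" "Im z = 0" using u w by auto
    then have "Re z > 0" using w(2) by (metis less_le_trans zero_less_mult_pos zero_less_one)
    then have "u * Re z \<le> 1 * Re z" using u by (intro mult_right_mono) auto
    with w(2) have "Re z \<ge> 1" by simp
    with z \<open>Im z = 0\<close> show False by (simp add: D_slit_def complex_is_Real_iff)
  qed
qed

lemma countable_discrete_real:
  fixes S :: "real set"
  assumes "\<And>x. x \<in> S \<Longrightarrow> \<not> x islimpt S"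
  shows "countable S"
proof -
  have "\<exists>T. open T \<and> T \<inter> S = {x}" if "x \<in> S" for x
  proof -
    have "x isolated_in S" using assms that by (simp add: isolated_in_islimpt_iff)
    then show ?thesis by (simp add: isolated_in_def)
  qed
  then obtain T where T: "\<And>x. x \<in> S \<Longrightarrow> open (T x)" "\<And>x. x \<in> S \<Longrightarrow> T x \<inter> S = {x}"
    by metis
  have "\<And>U. U \<in> T ` S \<Longrightarrow> open U" using T(1) by (elim imageE) simp
  then obtain F where F: "F \<subseteq> T ` S" "countable F" "\<Union>F = \<Union>(T ` S)"
    by (rule Lindelof)
  obtain C where C: "C \<subseteq> S" "countable C" "F = T ` C"
    using F(1,2) by (metis countable_subset_image)
  have "S \<subseteq> C"
  proof
    fix x assume x: "x \<in> S"
    then have "x \<in> T x" using T(2)[OF x] by (metis IntD1 singletonI)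
    then have "x \<in> \<Union>F" using F(3) x by (metis UN_I)
    then obtain c where c: "c \<in> C" "x \<in> T c" using C(3) by (metis UN_E)
    then have "x \<in> T c \<inter> S" using x by (intro IntI)
    moreover have "T c \<inter> S = {c}" using C(1) c(1) T(2) by (metis subsetD)
    ultimately show "x \<in> C" using c(1) by (metis singletonD)
  qed
  with C(2) show ?thesis by (meson countable_subset)
qed

lemma has_contour_integral_spike_point:
  assumes "valid_path \<gamma>" "(g has_contour_integral w) \<gamma>"
    and "\<And>z. z \<noteq> a \<Longrightarrow> f z = g z"
  shows "(f has_contour_integral w) \<gamma>"
proof -
  obtain K where K: "finite K" "\<And>x. x \<in> {0..1} - K \<Longrightarrow> \<gamma> differentiable (at x)"
    using assms(1) unfolding valid_path_def piecewise_C1_differentiable_on_def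
    by (auto simp: C1_differentiable_on_eq)
  define K' where "K' = K \<union> {0, 1}"
  define Z where "Z = {x \<in> {0..1} - K'. \<gamma> x = a \<and> vector_derivative \<gamma> (at x within {0..1}) \<noteq> 0}"
  have "\<not> x islimpt Z" if "x \<in> Z" for x
  proof
    assume lim: "x islimpt Z"
    have x: "0 < x" "x < 1" "x \<notin> K" "\<gamma> x = a"
      using that by (auto simp: Z_def K'_def)
    define d where "d = vector_derivative \<gamma> (at x)"
    have "at x within {0..1} = at x"
      using x by (intro at_within_interior) simp
    then have "d \<noteq> 0" using that by (simp add: Z_def d_def)
    have "(\<gamma> has_vector_derivative d) (at x)"
      using K(2)[of x] x unfolding d_def by (simp add: vector_derivative_works)
    then have "((\<lambda>y. norm ((\<gamma> y - \<gamma> x) - (y - x) *\<^sub>R d) / norm (y - x)) \<longlongrightarrow> 0) (at x)"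
      unfolding has_vector_derivative_def has_derivative_iff_norm by (rule conjunct2)
    then have "\<forall>\<^sub>F y in at x. norm ((\<gamma> y - \<gamma> x) - (y - x) *\<^sub>R d) / norm (y - x) < norm d"
      by (rule order_tendstoD) (simp add: \<open>d \<noteq> 0\<close>)
    moreover have "\<forall>\<^sub>F y in at x. y \<noteq> x" by (rule eventually_neq_at_within)
    ultimately have "\<forall>\<^sub>F y in at x. y \<notin> Z"
    proof eventually_elim
      case (elim y)
      show ?case
      proof
        assume "y \<in> Z"
        then have "\<gamma> y - \<gamma> x = 0" using x(4) by (simp add: Z_def)
        then have "norm ((\<gamma> y - \<gamma> x) - (y - x) *\<^sub>R d) = norm (y - x) * norm d" by simp
        with elim show False by simp
      qed
    qed
    with lim show False
      by (simp add: islimpt_iff_eventually)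
  qed
  then have "countable Z" by (rule countable_discrete_real)
  then have "countable (Z \<union> K')" using K(1) by (simp add: K'_def countable_finite)
  then have neg: "negligible (Z \<union> K')"
    unfolding negligible_iff_null_sets
    by (intro null_sets_completionI countable_imp_null_set_lborel)
  have "f (\<gamma> x) * vector_derivative \<gamma> (at x within {0..1}) =
        g (\<gamma> x) * vector_derivative \<gamma> (at x within {0..1})"
    if "x \<in> {0..1} - (Z \<union> K')" for x
  proof (cases "\<gamma> x = a")
    case True
    then have "vector_derivative \<gamma> (at x within {0..1}) = 0"
      using that unfolding Z_def by blast
    then show ?thesis by (simp only: mult_zero_right)
  next
    case False
    then have "f (\<gamma> x) = g (\<gamma> x)" by (rule assms(3))
    then show ?thesis by (simp only:)
  qed
  from has_integral_spike[OF neg this assms(2)[unfolded has_contour_integral_def]]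
  show ?thesis unfolding has_contour_integral_def .
qed

lemma log_kernel_integral:
  assumes hol: "f holomorphic_on D_slit" and f0: "f 0 = 0"
  defines "F \<equiv> \<lambda>z. contour_integral (linepath 0 z) (\<lambda>t. f t / t)"
  shows "F holomorphic_on D_slit" "F 0 = 0"
    and "\<And>\<gamma>. valid_path \<gamma> \<Longrightarrow> path_image \<gamma> \<subseteq> D_slit \<Longrightarrow> pathstart \<gamma> = 0 \<Longrightarrow>
           ((\<lambda>t. f t / t) has_contour_integral F (pathfinish \<gamma>)) \<gamma>"
proof -
  define g where "g = (\<lambda>t. if t = 0 then deriv f 0 else f t / t)"
  have g: "g holomorphic_on D_slit"
    using pole_lemma_open[OF hol open_D_slit, of 0] unfolding g_def f0 diff_zero .
  have "starlike D_slit"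
    unfolding starlike_def using zero_in_D_slit segment_D_slit by blast
  then obtain G where G: "\<And>x. x \<in> D_slit \<Longrightarrow> (G has_field_derivative g x) (at x)"
    using holomorphic_starlike_primitive[OF holomorphic_on_imp_continuous_on[OF g] _ open_D_slit finite.emptyI]
      holomorphic_on_imp_differentiable_at[OF g open_D_slit] by auto
  have int: "((\<lambda>t. f t / t) has_contour_integral (G (pathfinish \<gamma>) - G 0)) \<gamma>"
    if "valid_path \<gamma>" "path_image \<gamma> \<subseteq> D_slit" "pathstart \<gamma> = 0" for \<gamma>
  proof (rule has_contour_integral_spike_point[OF that(1), where a = 0])
    show "(g has_contour_integral (G (pathfinish \<gamma>) - G 0)) \<gamma>"
      using contour_integral_primitive[of D_slit G g \<gamma>] G that
      by (simp add: has_field_derivative_at_within)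
  qed (simp add: g_def)
  have F: "F z = G z - G 0" if "z \<in> D_slit" for z
    unfolding F_def using int[of "linepath 0 z"] segment_D_slit[OF that]
    by (intro contour_integral_unique) simp
  show "F 0 = 0" using F zero_in_D_slit by simp
  have "(\<lambda>z. G z - G 0) holomorphic_on D_slit"
    by (intro holomorphic_intros)
       (meson G holomorphic_onI field_differentiable_at_within field_differentiable_def)
  then show "F holomorphic_on D_slit"
    using F by (simp cong: holomorphic_cong)
  show "((\<lambda>t. f t / t) has_contour_integral F (pathfinish \<gamma>)) \<gamma>"
    if "valid_path \<gamma>" "path_image \<gamma> \<subseteq> D_slit" "pathstart \<gamma> = 0" for \<gamma>
    using int[OF that] F[of "pathfinish \<gamma>"] pathfinish_in_path_image[of \<gamma>] that by auto
qed

lemma polylog_holomorphic: "polylog (Suc k) holomorphic_on D_slit \<and> polylog (Suc k) 0 = 0"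
proof (induction k)
  case 0
  have "(\<lambda>z. - Ln (1 - z)) holomorphic_on D_slit"
    by (intro holomorphic_intros) (use one_minus_D_slit in auto)
  moreover have "polylog (Suc 0) = (\<lambda>z. - Ln (1 - z))" by auto
  ultimately show ?case by simp
next
  case (Suc k)
  have "polylog (Suc (Suc k)) = (\<lambda>z. contour_integral (linepath 0 z) (\<lambda>t. polylog (Suc k) t / t))"
    by auto
  with log_kernel_integral(1,2)[of "polylog (Suc k)"] Suc show ?case by simp
qed

lemma polylog_contour:
  assumes "k \<ge> 2" "valid_path \<gamma>" "path_image \<gamma> \<subseteq> D_slit" "pathstart \<gamma> = 0"
  shows "((\<lambda>t. polylog (k - 1) t / t) has_contour_integral polylog k (pathfinish \<gamma>)) \<gamma>"
proof -
  obtain m where m: "k = Suc (Suc m)" using assms(1) by (metis Suc_le_D numeral_2_eq_2 Suc_le_mono)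
  show ?thesis
    using log_kernel_integral(3)[of "polylog (Suc m)" \<gamma>] polylog_holomorphic[of m] assms
    by (simp add: m)
qed

lemma polylog_2_ones_contour:
  assumes "k \<ge> 2" "valid_path \<gamma>" "path_image \<gamma> \<subseteq> D_slit" "pathstart \<gamma> = 0"
  shows "((\<lambda>t. (-1) ^ (k - 1) / fact (k - 1) * (Ln (1 - t) ^ (k - 1) / t))
           has_contour_integral polylog_2_ones k (pathfinish \<gamma>)) \<gamma>"
proof -
  let ?f = "\<lambda>t. (-1) ^ (k - 1) / fact (k - 1) * Ln (1 - t) ^ (k - 1) :: complex"
  have "?f holomorphic_on D_slit"
    by (intro holomorphic_intros) (use one_minus_D_slit in auto)
  moreover have "?f 0 = 0" using assms(1) by simp
  ultimately show ?thesis
    using log_kernel_integral(3)[of ?f \<gamma>] assms by (simp add: polylog_2_ones_def)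
qed

end

theory Submission
  imports Defs "HOL-Real_Asymp.Real_Asymp"
begin

text \<open>
  Once the lower weights are known, the functional relation prescribes the sum \<open>f\<^sub>k\<^sup>+ + f\<^sub>k\<^sup>-\<close> on the
  strip \<^term>\<open>D_plus \<inter> D_minus\<close>, and such an additive decomposition is rigid: if
  \<open>U + V = 0\<close> on the strip, then \<open>U\<close> and \<open>- V\<close> glue to an entire function, because the two half-planes
  cover the plane. When \<open>U'\<close> and \<open>V'\<close> tend to \<open>0\<close> at infinity, Liouville's theorem makes
  the derivative of the entire function vanish, so it is constant, and the normalization
  \<open>U 0 = 0\<close> makes it \<open>0\<close> (lemma \<open>additive_decomposition_unique\<close>).

  It therefore suffices to know that the polylogarithms themselves satisfy the same conditions.
  By induction on \<open>k\<close>, the relations for the given functions and for the polylogarithms then have the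
  same middle sum, and their difference is \<open>U + V = 0\<close> with \<open>U = f\<^sub>k\<^sup>+ - Li\<^sub>k\<close> and
  \<open>V z = f\<^sub>k\<^sup>- z - polylog_2_ones k (1 - z)\<close>.

  The functional relation for the polylogarithms (lemma \<open>polylog_functional_relation\<close>) holds because
  \<open>Li\<^sub>k' = Li\<^sub>k\<^sub>-\<^sub>1 / z\<close> makes the derivative of the sum telescope to \<open>0\<close>; the constant is found by
  letting \<open>z\<close> increase to \<open>1\<close> on the real axis, where \<open>Li\<^sub>k\<close> tends to \<open>\<zeta>(k)\<close> and all other terms
  vanish. The asymptotic conditions (lemmas \<open>deriv_polylog_tendsto_0\<close> and
  \<open>deriv_polylog_2_ones_tendsto_0\<close>) hold because \<open>Li\<^sub>k\<^sub>-\<^sub>1\<close> and the powers of the logarithm grow more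
  slowly than \<open>z\<close>.
\<close>

section \<open>Derivatives\<close>

lemma D_plus_subset_D_slit: "D_plus \<subseteq> D_slit"
  by (auto simp: D_plus_def D_slit_def)

lemma one_minus_D_minus: "z \<in> D_minus \<Longrightarrow> 1 - z \<in> D_slit"
  by (auto simp: D_minus_def D_slit_def)

lemma open_D_plus: "open D_plus" and open_D_minus: "open D_minus"
  by (simp_all add: D_plus_def D_minus_def open_halfspace_Re_lt open_halfspace_Re_gt)

text \<open>
  The integrand has a removable singularity at \<open>0\<close>, since \<open>f\<close> vanishes there. On the star-shaped
  domain the completed integrand has a primitive, and the integral along the segment is the increment
  of that primitive.
\<close>

lemma log_kernel_has_field_derivative:
  assumes hol: "f holomorphic_on D_slit" and f0: "f 0 = 0"
    and z: "z \<in> D_slit" "z \<noteq> 0"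
  shows "((\<lambda>w. contour_integral (linepath 0 w) (\<lambda>t. f t / t)) has_field_derivative f z / z) (at z)"
proof -
  define g where "g = (\<lambda>t. if t = 0 then deriv f 0 else f t / t)"
  have g: "g holomorphic_on D_slit"
    using pole_lemma_open[OF hol open_D_slit, of 0] unfolding g_def f0 diff_zero .
  have "starlike D_slit"
    unfolding starlike_def using zero_in_D_slit segment_D_slit by blast
  then obtain G where G: "\<And>x. x \<in> D_slit \<Longrightarrow> (G has_field_derivative g x) (at x)"
    using holomorphic_starlike_primitive[OF holomorphic_on_imp_continuous_on[OF g] _ open_D_slit finite.emptyI]
      holomorphic_on_imp_differentiable_at[OF g open_D_slit] by auto
  have eq: "contour_integral (linepath 0 w) (\<lambda>t. f t / t) = G w - G 0" if w: "w \<in> D_slit" for w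
  proof (rule contour_integral_unique, rule has_contour_integral_spike_point[where a = 0])
    show "(g has_contour_integral G w - G 0) (linepath 0 w)"
      using contour_integral_primitive[of D_slit G g "linepath 0 w"] G segment_D_slit[OF w]
      by (simp add: has_field_derivative_at_within)
  qed (simp_all add: g_def)
  have "((\<lambda>w. G w - G 0) has_field_derivative f z / z) (at z)"
    using G[OF z(1)] z(2) by (auto intro!: derivative_eq_intros simp: g_def)
  then show ?thesis
    by (rule has_field_derivative_transform_within_open[OF _ open_D_slit z(1)]) (simp add: eq)
qed

text \<open>
  The value \<open>z / (1 - z)\<close> in weight \<open>0\<close> makes this recursion uniform: it also covers
  \<open>Li\<^sub>1' = 1 / (1 - z)\<close>.
\<close>

lemma polylog_Suc_has_field_derivative:
  assumes "z \<in> D_slit" "z \<noteq> 0"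
  shows "(polylog (Suc k) has_field_derivative polylog k z / z) (at z)"
proof (cases k)
  case 0
  have "polylog (Suc 0) = (\<lambda>z. - Ln (1 - z))" by auto
  moreover have "((\<lambda>z. - Ln (1 - z)) has_field_derivative 1 / (1 - z)) (at z)"
    using one_minus_D_slit[OF assms(1)] by (auto intro!: derivative_eq_intros simp: inverse_eq_divide)
  ultimately show ?thesis using 0 assms by simp
next
  case (Suc m)
  have "polylog (Suc (Suc m)) = (\<lambda>w. contour_integral (linepath 0 w) (\<lambda>t. polylog (Suc m) t / t))"
    by auto
  then show ?thesis
    using log_kernel_has_field_derivative[of "polylog (Suc m)"] polylog_holomorphic[of m] assms Suc
    by metis
qed

lemma polylog_2_ones_holomorphic:
  assumes "k \<ge> 2"
  shows "polylog_2_ones k holomorphic_on D_slit" "polylog_2_ones k 0 = 0"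
    and "z \<in> D_slit \<Longrightarrow> z \<noteq> 0 \<Longrightarrow> (polylog_2_ones k has_field_derivative
           (-1) ^ (k - 1) / fact (k - 1) * Ln (1 - z) ^ (k - 1) / z) (at z)"
proof -
  let ?f = "\<lambda>t. (-1) ^ (k - 1) / fact (k - 1) * Ln (1 - t) ^ (k - 1) :: complex"
  have f: "?f holomorphic_on D_slit" "?f 0 = 0"
    using assms by (auto intro!: holomorphic_intros simp: one_minus_D_slit)
  have eq: "polylog_2_ones k = (\<lambda>z. contour_integral (linepath 0 z) (\<lambda>t. ?f t / t))"
    by (simp add: fun_eq_iff polylog_2_ones_def)
  show "polylog_2_ones k holomorphic_on D_slit" "polylog_2_ones k 0 = 0"
    unfolding eq by (rule log_kernel_integral[OF f])+
  show "z \<in> D_slit \<Longrightarrow> z \<noteq> 0 \<Longrightarrow> (polylog_2_ones k has_field_derivative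
           (-1) ^ (k - 1) / fact (k - 1) * Ln (1 - z) ^ (k - 1) / z) (at z)"
    unfolding eq by (rule log_kernel_has_field_derivative[OF f])
qed

lemma polylog_2_ones_reflected_has_field_derivative:
  assumes "k \<ge> 2" "z \<in> D_minus" "z \<noteq> 1"
  shows "((\<lambda>z. polylog_2_ones k (1 - z)) has_field_derivative
           - ((-1) ^ (k - 1) / fact (k - 1) * Ln z ^ (k - 1) / (1 - z))) (at z)"
proof -
  have "((\<lambda>z. 1 - z) has_field_derivative - 1) (at z)"
    by (auto intro!: derivative_eq_intros)
  from DERIV_chain2[OF polylog_2_ones_holomorphic(3)[OF assms(1) one_minus_D_minus[OF assms(2)]] this]
  show ?thesis using assms(3) by simp
qed

section \<open>Decay of the derivatives at infinity\<close>

text \<open>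
  Moving radially outwards from a fixed large circle, \<open>F\<close> changes by at most \<open>e / 2\<close> times the
  distance covered, and on that circle it is bounded. This lemma carries the decay of the derivative from
  one weight to the next, without any explicit growth estimate for polylogarithms.
\<close>

lemma sublinear_if_deriv_tendsto_0:
  assumes hol: "F holomorphic_on D_slit"
    and lim: "(deriv F \<longlongrightarrow> 0) (inf at_infinity (principal D_plus))"
  shows "((\<lambda>z. F z / z) \<longlongrightarrow> 0) (inf at_infinity (principal D_plus))"
proof (rule tendstoI)
  fix e :: real assume e: "e > 0"
  have "\<forall>\<^sub>F z in inf at_infinity (principal D_plus). dist (deriv F z) 0 < e / 2"
    using lim e by (intro tendstoD) auto
  then obtain R' where R': "\<And>z. norm z \<ge> R' \<Longrightarrow> z \<in> D_plus \<Longrightarrow> norm (deriv F z) < e / 2"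
    by (auto simp: eventually_inf_principal eventually_at_infinity)
  define R where "R = max 2 R'"
  have R: "R \<ge> 2" "\<And>z. norm z \<ge> R \<Longrightarrow> z \<in> D_plus \<Longrightarrow> norm (deriv F z) \<le> e / 2"
    using R' by (auto simp: R_def less_imp_le)
  \<comment> \<open>The sphere of radius \<open>R \<ge> 2\<close> avoids the branch point, so \<open>F\<close> is bounded on its part in the
      closed half-plane.\<close>
  define K where "K = sphere 0 R \<inter> {z. Re z \<le> 1}"
  have "z \<in> D_slit" if "z \<in> K" for z
  proof (rule ccontr)
    assume "z \<notin> D_slit"
    then have "z \<in> \<real>" "Re z \<ge> 1" by (auto simp: D_slit_def)
    with that have "z = 1" by (auto simp: K_def complex_is_Real_iff complex_eq_iff)
    with that R(1) show False by (simp add: K_def)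
  qed
  then have "continuous_on K F"
    by (intro holomorphic_on_imp_continuous_on holomorphic_on_subset[OF hol]) auto
  moreover have "compact K"
    unfolding K_def by (intro compact_Int_closed compact_sphere closed_halfspace_Re_le)
  ultimately have "bounded (F ` K)"
    by (intro compact_imp_bounded compact_continuous_image)
  then obtain M where M: "M > 0" "\<And>z. z \<in> K \<Longrightarrow> norm (F z) \<le> M"
    by (auto simp: bounded_pos)
  have "norm (F z / z) < e" if z: "z \<in> D_plus" "norm z \<ge> R" "norm z > 2 * M / e" for z
  proof -
    have z0: "norm z > 0" using z(2) R(1) by linarith
    \<comment> \<open>The point of the circle of radius \<open>R\<close> on the ray through \<open>z\<close>; the segment from there to
        \<open>z\<close> stays in the half-plane.\<close>
    define w where "w = of_real (R / norm z) * z"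
    have seg: "x \<in> D_plus \<and> norm x \<ge> R" if "x \<in> closed_segment w z" for x
    proof -
      obtain u where u: "0 \<le> u" "u \<le> 1" "x = (1 - u) *\<^sub>R w + u *\<^sub>R z"
        using \<open>x \<in> closed_segment w z\<close> by (auto simp: in_segment)
      define t where "t = (1 - u) * (R / norm z) + u"
      have xt: "x = of_real t * z"
        by (simp add: u(3) w_def t_def scaleR_conv_of_real algebra_simps)
      have "R / norm z \<le> 1" using z(2) z0 by simp
      then have t1: "t \<le> 1"
        using u convex_bound_le[of "R / norm z" 1 1 "1 - u" u] by (simp add: t_def)
      have "(1 - u) * R + u * R \<le> (1 - u) * R + u * norm z"
        using u z(2) by (intro add_left_mono mult_left_mono) auto
      moreover have "t * norm z = (1 - u) * R + u * norm z"
        using z0 by (simp add: t_def distrib_right)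
      ultimately have "R \<le> t * norm z" by (simp add: algebra_simps)
      moreover have t0: "t \<ge> 0" using u R(1) by (simp add: t_def)
      ultimately have "norm x \<ge> R" by (simp add: xt norm_mult)
      moreover have "t * Re z < 1"
      proof (cases "Re z \<le> 0")
        case True
        then show ?thesis using t0 by (smt (verit) mult_nonneg_nonpos)
      next
        case False
        then have "t * Re z \<le> 1 * Re z" using t1 by (intro mult_right_mono) auto
        with z(1) show ?thesis by (simp add: D_plus_def)
      qed
      ultimately show ?thesis by (simp add: D_plus_def xt)
    qed
    have nw: "norm w = R" using z0 R(1) unfolding w_def norm_mult norm_of_real by simp
    have "w \<in> K" using seg[of w] nw by (simp add: K_def D_plus_def)
    have "norm (F z - F w) \<le> e / 2 * norm (z - w)"
    proof (rule field_differentiable_bound[where S = "closed_segment w z"])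
      show "(F has_field_derivative deriv F x) (at x within closed_segment w z)"
        if "x \<in> closed_segment w z" for x
        using holomorphic_derivI[OF hol open_D_slit] seg[OF that] D_plus_subset_D_slit
        by (meson has_field_derivative_at_within subsetD)
    qed (use seg R(2) in auto)
    also have "norm (z - w) \<le> norm z"
    proof -
      have "z - w = of_real (1 - R / norm z) * z" by (simp add: w_def algebra_simps)
      then have "norm (z - w) = \<bar>1 - R / norm z\<bar> * norm z" by (metis norm_mult norm_of_real)
      also have "\<dots> \<le> 1 * norm z"
        using z(2) z0 R(1) by (intro mult_right_mono) (auto simp: abs_le_iff field_simps)
      finally show ?thesis by simp
    qed
    finally have "norm (F z - F w) \<le> e / 2 * norm z" using e by simp
    then have "norm (F z) \<le> e / 2 * norm z + M"
      using M(2)[OF \<open>w \<in> K\<close>] norm_triangle_sub[of "F z" "F w"] by linarith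
    also have "\<dots> < e * norm z" using z(3) e by (simp add: field_simps)
    finally show ?thesis using z0 by (simp add: norm_divide divide_simps)
  qed
  then show "\<forall>\<^sub>F z in inf at_infinity (principal D_plus). dist (F z / z) 0 < e"
    unfolding eventually_inf_principal eventually_at_infinity
    by (intro exI[of _ "max R (2 * M / e + 1)"]) auto
qed

text \<open>
  The bound \<open>2\<close> only serves to keep away from the exceptional points \<open>0\<close> and \<open>1\<close> of the derivative
  formulas.
\<close>

lemma eventually_in_set_and_large:
  fixes S :: "complex set"
  shows "\<forall>\<^sub>F z in inf at_infinity (principal S). z \<in> S \<and> norm z > 2"
  unfolding eventually_inf_principal eventually_at_infinity by (intro exI[of _ 3]) auto

lemma Ln_power_over_linear_tendsto_0:
  "((\<lambda>z. Ln z ^ n / (1 - z)) \<longlongrightarrow> 0) at_infinity"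
proof (rule Lim_null_comparison)
  show "\<forall>\<^sub>F z in at_infinity. norm (Ln z ^ n / (1 - z)) \<le> (ln (norm z) + pi) ^ n / (norm z - 1)"
    unfolding eventually_at_infinity
  proof (intro exI[of _ 2] allI impI)
    fix z :: complex assume z: "norm z \<ge> 2"
    then have "z \<noteq> 0" by auto
    have "norm (Ln z) \<le> \<bar>Re (Ln z)\<bar> + \<bar>Im (Ln z)\<bar>" by (rule cmod_le)
    also have "\<dots> \<le> ln (norm z) + pi"
      using z mpi_less_Im_Ln[OF \<open>z \<noteq> 0\<close>] Im_Ln_le_pi[OF \<open>z \<noteq> 0\<close>] by (simp add: \<open>z \<noteq> 0\<close> Re_Ln)
    finally have "norm (Ln z ^ n) \<le> (ln (norm z) + pi) ^ n"
      by (simp add: norm_power power_mono)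
    moreover have "norm z - 1 \<le> norm (1 - z)"
      by (metis norm_minus_commute norm_one norm_triangle_ineq2)
    ultimately show "norm (Ln z ^ n / (1 - z)) \<le> (ln (norm z) + pi) ^ n / (norm z - 1)"
      using z unfolding norm_divide by (intro frac_le) auto
  qed
  have "((\<lambda>x::real. (ln x + pi) ^ n / (x - 1)) \<longlongrightarrow> 0) at_top"
    by real_asymp
  then show "((\<lambda>z. (ln (norm z) + pi) ^ n / (norm z - 1)) \<longlongrightarrow> 0) (at_infinity :: complex filter)"
    by (rule filterlim_compose) (rule filterlim_norm_at_top)
qed

text \<open>
  Induction on the weight: if \<open>Li\<^sub>k'\<close> tends to \<open>0\<close>, then \<open>Li\<^sub>k\<close> is sublinear, so
  \<open>Li\<^sub>k\<^sub>+\<^sub>1' = Li\<^sub>k / z\<close> tends to \<open>0\<close>.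
\<close>

lemma deriv_polylog_tendsto_0:
  "(deriv (polylog (Suc k)) \<longlongrightarrow> 0) (inf at_infinity (principal D_plus))"
proof (induction k)
  case 0
  have "((\<lambda>z::complex. inverse (1 - z)) \<longlongrightarrow> 0) at_infinity"
    using Ln_power_over_linear_tendsto_0[of 0] by (simp add: inverse_eq_divide)
  then have "((\<lambda>z::complex. inverse (1 - z)) \<longlongrightarrow> 0) (inf at_infinity (principal D_plus))"
    by (rule tendsto_mono[rotated]) simp
  then show ?case
  proof (rule Lim_transform_eventually)
    show "\<forall>\<^sub>F z in inf at_infinity (principal D_plus). inverse (1 - z) = deriv (polylog (Suc 0)) z"
      using eventually_in_set_and_large
    proof eventually_elim
      case (elim z)
      then have "z \<in> D_slit" "z \<noteq> 0" using D_plus_subset_D_slit by auto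
      from polylog_Suc_has_field_derivative[OF this, of 0]
      show ?case using \<open>z \<noteq> 0\<close> by (simp add: DERIV_imp_deriv inverse_eq_divide)
    qed
  qed
next
  case (Suc k)
  have "((\<lambda>z. polylog (Suc k) z / z) \<longlongrightarrow> 0) (inf at_infinity (principal D_plus))"
    using polylog_holomorphic Suc.IH by (intro sublinear_if_deriv_tendsto_0) auto
  then show ?case
  proof (rule Lim_transform_eventually)
    show "\<forall>\<^sub>F z in inf at_infinity (principal D_plus).
            polylog (Suc k) z / z = deriv (polylog (Suc (Suc k))) z"
      using eventually_in_set_and_large
    proof eventually_elim
      case (elim z)
      then have "z \<in> D_slit" "z \<noteq> 0" using D_plus_subset_D_slit by auto
      from polylog_Suc_has_field_derivative[OF this, of "Suc k"]
      show ?case by (metis DERIV_imp_deriv)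
    qed
  qed
qed

lemma deriv_polylog_2_ones_tendsto_0:
  assumes "k \<ge> 2"
  shows "(deriv (\<lambda>z. polylog_2_ones k (1 - z)) \<longlongrightarrow> 0) (inf at_infinity (principal D_minus))"
proof -
  define c where "c = - ((-1) ^ (k - 1) / fact (k - 1) :: complex)"
  have "((\<lambda>z. c * (Ln z ^ (k - 1) / (1 - z))) \<longlongrightarrow> 0) (inf at_infinity (principal D_minus))"
    by (intro tendsto_mult_right_zero tendsto_mono[OF _ Ln_power_over_linear_tendsto_0]) simp
  then show ?thesis
  proof (rule Lim_transform_eventually)
    show "\<forall>\<^sub>F z in inf at_infinity (principal D_minus).
            c * (Ln z ^ (k - 1) / (1 - z)) = deriv (\<lambda>z. polylog_2_ones k (1 - z)) z"
      using eventually_in_set_and_large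
    proof eventually_elim
      case (elim z)
      then have "z \<in> D_minus" "z \<noteq> 1" by auto
      from polylog_2_ones_reflected_has_field_derivative[OF assms this]
      show ?case by (simp add: DERIV_imp_deriv c_def)
    qed
  qed
qed

section \<open>Behaviour at the branch point\<close>

text \<open>
  Both sides vanish at \<open>0\<close>, and by induction they have the same derivative on the punctured disc. The
  factor \<open>z\<close> is pulled out of the usual series \<open>\<Sum> z\<^sup>n / n\<^sup>k\<close> so that the remaining series is what
  termwise differentiation produces in the next weight.
\<close>

lemma polylog_power_series:
  assumes "norm z < 1"
  shows "polylog k z = z * (\<Sum>n. z ^ n / of_nat (Suc n) ^ k)"
  using assms
proof (induction k arbitrary: z)
  case 0
  then show ?case by (simp add: suminf_geometric)
next
  case (Suc k)
  \<comment> \<open>Here \<open>c 0 = 1 / 0 = 0\<close>, as the series without constant term requires.\<close>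
  define c :: "nat \<Rightarrow> complex" where "c = (\<lambda>n. 1 / of_nat n ^ Suc k)"
  define S where "S = (\<lambda>z. \<Sum>n. c n * z ^ n)"
  have summable: "summable (\<lambda>n. c n * z ^ n)" if "norm z < 1" for z
  proof (rule summable_comparison_test'[of "\<lambda>n. norm z ^ n" 0])
    show "norm (c n * z ^ n) \<le> norm z ^ n" for n
    proof (cases "n = 0")
      case False
      then have "1 / real n ^ Suc k \<le> 1" by (simp add: one_le_power del: power_Suc)
      then show ?thesis
        using mult_right_mono[of "1 / real n ^ Suc k" 1 "norm z ^ n"]
        by (simp add: c_def norm_mult norm_divide norm_power del: power_Suc)
    qed (simp add: c_def)
  qed (use that in \<open>simp add: summable_geometric\<close>)
  have diffs: "diffs c n = 1 / of_nat (Suc n) ^ k" for n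
    using of_nat_neq_0[of n, where 'a = complex] by (simp add: diffs_def c_def del: of_nat_Suc)
  have dS: "(S has_field_derivative (\<Sum>n. z ^ n / of_nat (Suc n) ^ k)) (at z)" if "norm z < 1" for z
    using termdiffs_strong'[of 1 c z] summable that by (simp add: S_def diffs)
  have S: "S z = z * (\<Sum>n. z ^ n / of_nat (Suc n) ^ Suc k)" if "norm z < 1" for z
  proof -
    have "S z = (\<Sum>n. c (Suc n) * z ^ Suc n) + c 0 * z ^ 0"
      unfolding S_def by (rule suminf_split_head[OF summable[OF that], THEN eq_diff_eq[THEN iffD1], symmetric])
    also have "\<dots> = (\<Sum>n. z * (z ^ n / of_nat (Suc n) ^ Suc k))"
      by (simp add: c_def)
    also have "\<dots> = z * (\<Sum>n. z ^ n / of_nat (Suc n) ^ Suc k)"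
    proof (cases "z = 0")
      case False
      have "summable (\<lambda>n. z * (z ^ n / of_nat (Suc n) ^ Suc k))"
        using summable[OF that, THEN summable_Suc_iff[THEN iffD2]] by (simp add: c_def)
      then have "summable (\<lambda>n. z ^ n / of_nat (Suc n) ^ Suc k)"
        using False by (subst (asm) summable_cmult_iff) simp
      then show ?thesis by (rule suminf_mult)
    qed simp
    finally show ?thesis .
  qed
  have sub: "ball 0 1 \<subseteq> D_slit"
  proof
    fix w :: complex assume "w \<in> ball 0 1"
    then have "Re w < 1" using complex_Re_le_cmod[of w] by simp
    then show "w \<in> D_slit" by (simp add: D_slit_def)
  qed
  have "\<exists>C. \<forall>x\<in>ball 0 1. polylog (Suc k) x - S x = C"
  proof -
    have "continuous_on (ball 0 1) (polylog (Suc k))"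
      using polylog_holomorphic[of k] sub
      by (meson holomorphic_on_imp_continuous_on holomorphic_on_subset)
    moreover have "continuous_on (ball 0 1) S"
      using dS by (intro DERIV_continuous_on) (auto intro: has_field_derivative_at_within)
    ultimately have "continuous_on (ball 0 1) (\<lambda>x. polylog (Suc k) x - S x)"
      by (intro continuous_intros)
    moreover have "\<forall>x\<in>ball 0 1 - {0}. ((\<lambda>x. polylog (Suc k) x - S x) has_field_derivative 0) (at x)"
    proof
      fix x :: complex assume x: "x \<in> ball 0 1 - {0}"
      then have "x \<in> D_slit" "x \<noteq> 0" using sub by auto
      from DERIV_diff[OF polylog_Suc_has_field_derivative[OF this, of k] dS[of x]]
      show "((\<lambda>x. polylog (Suc k) x - S x) has_field_derivative 0) (at x)"
        using Suc.IH[of x] x by simp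
    qed
    ultimately have "(\<lambda>x. polylog (Suc k) x - S x) constant_on ball 0 1"
      by (intro DERIV_zero_connected_constant_on[where K = "{0}"]) simp_all
    then show ?thesis by (simp add: constant_on_def)
  qed
  then obtain C where C: "\<And>x. norm x < 1 \<Longrightarrow> polylog (Suc k) x - S x = C" by auto
  have "S 0 = 0" using S[of 0] by simp
  then have "C = 0" using C[of 0] polylog_holomorphic[of k] by simp
  then show ?case using C[OF Suc.prems] S[OF Suc.prems] by simp
qed

text \<open>
  For \<open>k \<ge> 2\<close> the power series converges uniformly on the closed unit disc, so it is continuous up to
  the point \<open>1\<close>.
\<close>

lemma polylog_tendsto_zeta:
  assumes "k \<ge> 2"
  shows "((\<lambda>x::real. polylog k (of_real x)) \<longlongrightarrow> zeta_nat k) (at_left 1)"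
proof -
  define T :: "complex \<Rightarrow> complex" where "T = (\<lambda>z. \<Sum>n. z ^ n / of_nat (Suc n) ^ k)"
  have "uniform_limit (cball 0 1) (\<lambda>N z. \<Sum>n<N. z ^ n / of_nat (Suc n) ^ k) T sequentially"
    unfolding T_def
  proof (rule Weierstrass_m_test)
    show "summable (\<lambda>n. 1 / real (Suc n) ^ k)"
      using inverse_power_summable[OF assms, where 'a = real] 
      by (subst summable_Suc_iff) (simp add: field_simps)
    show "norm (z ^ n / of_nat (Suc n) ^ k) \<le> 1 / real (Suc n) ^ k" if "z \<in> cball 0 1" for n and z :: complex
      using that unfolding norm_divide norm_power norm_of_nat
      by (intro divide_right_mono) (auto simp: power_le_one)
  qed
  then have "continuous_on (cball 0 1) T"
    by (rule uniform_limit_theorem[rotated]) (auto intro!: always_eventually continuous_intros simp del: of_nat_Suc)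
  then have "continuous_on {0..1::real} (\<lambda>x. T (of_real x))"
    by (rule continuous_on_compose2) (auto intro!: continuous_intros)
  then have "((\<lambda>x. T (of_real x)) \<longlongrightarrow> T (of_real 1)) (at 1 within {0..1::real})"
    unfolding continuous_on_def by (rule bspec) simp
  moreover have "at 1 within {0..1::real} = at_left 1" by (rule at_within_Icc_at_left) simp
  ultimately have "((\<lambda>x::real. of_real x * T (of_real x)) \<longlongrightarrow> of_real 1 * T 1) (at_left 1)"
    by (intro tendsto_mult tendsto_of_real tendsto_ident_at) simp
  moreover have "T 1 = zeta_nat k" by (simp add: T_def zeta_nat_def)
  ultimately have "((\<lambda>x::real. of_real x * T (of_real x)) \<longlongrightarrow> zeta_nat k) (at_left 1)" by simp
  then show ?thesis
  proof (rule Lim_transform_eventually)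
    have "\<forall>\<^sub>F x::real in at_left 1. x \<in> {0<..<1}" by (rule eventually_at_left_real) simp
    then show "\<forall>\<^sub>F x::real in at_left 1. of_real x * T (of_real x) = polylog k (of_real x)"
      by eventually_elim (simp add: polylog_power_series T_def)
  qed
qed

section \<open>The functional relation for the polylogarithms\<close>

text \<open>
  The derivative of the \<open>j\<close>-th summand has two parts, from the logarithm and from the polylogarithm; the
  first one cancels the second part of the summand before it. Only the last polylogarithm part
  survives.
\<close>

lemma polylog_relation_telescopes:
  assumes z: "z \<in> D_plus \<inter> D_minus" and "n \<le> m"
  shows "((\<lambda>z. \<Sum>j\<le>n. (-1) ^ j * Ln z ^ j / fact j * polylog (Suc m - j) z) has_field_derivative
           (-1) ^ n * Ln z ^ n / fact n * polylog (m - n) z / z) (at z)"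
proof -
  have z': "z \<in> D_slit" "z \<noteq> 0" "z \<notin> \<real>\<^sub>\<le>\<^sub>0"
    using z D_plus_subset_D_slit by (auto simp: D_minus_def complex_nonpos_Reals_iff)
  have pl: "(polylog (Suc m - j) has_field_derivative polylog (m - j) z / z) (at z)" if "j \<le> m" for j
    using polylog_Suc_has_field_derivative[OF z'(1,2), of "m - j"] that by (simp add: Suc_diff_le)
  show ?thesis
    using \<open>n \<le> m\<close>
  proof (induction n)
    case 0
    then show ?case using pl[of 0] by simp
  next
    case (Suc n)
    have "((\<lambda>z. (-1) ^ Suc n * Ln z ^ Suc n / fact (Suc n)) has_field_derivative
            - ((-1) ^ n * Ln z ^ n / fact n) / z) (at z)"
    proof -
      have "((\<lambda>z. Ln z ^ Suc n) has_field_derivative of_nat (Suc n) * Ln z ^ n / z) (at z)"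
        using DERIV_power[OF has_field_derivative_Ln[OF z'(3)], of "Suc n"]
        by (simp add: field_simps)
      from DERIV_cmult[OF this, of "(-1) ^ Suc n / fact (Suc n)"]
      show ?thesis using of_nat_neq_0[of n, where 'a = complex]
        by (simp add: fact_Suc divide_simps del: of_nat_Suc power_Suc) (simp add: divide_simps)
    qed
    from DERIV_add[OF Suc.IH DERIV_mult[OF this pl[of "Suc n"]]] Suc.prems
    show ?case by (simp add: mult_ac del: power_Suc fact_Suc)
  qed
qed

text \<open>
  The polylogarithm of weight at least \<open>2\<close> has a finite limit at \<open>1\<close>, and \<open>Ln\<close> vanishes there. In weight
  \<open>1\<close> the factor \<open>Ln (1 - x)\<close> is unbounded, but a positive power of \<open>Ln x\<close> outweighs it.
\<close>

lemma polylog_relation_terms_vanish: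
  assumes "1 \<le> j" "j < k"
  shows "((\<lambda>x::real. (-1) ^ j * Ln (of_real x) ^ j / fact j * polylog (k - j) (of_real x)) \<longlongrightarrow> 0)
           (at_left 1)"
proof -
  have "((\<lambda>x::real. Ln (of_real x) ^ j * polylog (k - j) (of_real x)) \<longlongrightarrow> 0) (at_left 1)"
  proof (cases "k - j = 1")
    case True
    obtain i where i: "j = Suc i" using assms(1) by (cases j) auto
    have lim: "((\<lambda>x::real. ln x ^ j * - ln (1 - x)) \<longlongrightarrow> 0) (at_left 1)"
      unfolding i by real_asymp
    have "((\<lambda>x::real. of_real (ln x ^ j * - ln (1 - x))) \<longlongrightarrow> (of_real 0 :: complex)) (at_left 1)"
      using lim by (rule tendsto_of_real)
    then have "((\<lambda>x::real. of_real (ln x ^ j * - ln (1 - x))) \<longlongrightarrow> (0 :: complex)) (at_left 1)"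
      by simp
    then show ?thesis
    proof (rule Lim_transform_eventually)
      have "\<forall>\<^sub>F x::real in at_left 1. x \<in> {0<..<1}" by (rule eventually_at_left_real) simp
      then show "\<forall>\<^sub>F x::real in at_left 1. (of_real (ln x ^ j * - ln (1 - x)) :: complex) =
                   Ln (of_real x) ^ j * polylog (k - j) (of_real x)"
      proof eventually_elim
        case (elim x)
        then have "Ln (1 - of_real x) = of_real (ln (1 - x))"
          using Ln_of_real[of "1 - x"] by simp
        then show ?case using elim True by (simp add: Ln_of_real)
      qed
    qed
  next
    case False
    have "((\<lambda>x::real. Ln (of_real x) ^ j) \<longlongrightarrow> Ln (of_real 1) ^ j) (at_left 1)"
      by (intro tendsto_intros) simp
    then have "((\<lambda>x::real. Ln (of_real x) ^ j) \<longlongrightarrow> 0) (at_left 1)"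
      using assms(1) by (simp add: power_0_left)
    from tendsto_mult[OF this polylog_tendsto_zeta[of "k - j"]] show ?thesis
      using False assms by simp
  qed
  from tendsto_mult_right_zero[OF this, of "(-1) ^ j / fact j"] show ?thesis by (simp add: mult.assoc)
qed

text \<open>
  The sum telescopes to a last term whose weight-\<open>0\<close> factor is \<open>z / (1 - z)\<close>. The derivative of
  \<open>polylog_2_ones k (1 - z)\<close> cancels that term, so the left-hand side is constant, and its limit at \<open>1\<close>
  gives the constant.
\<close>

lemma polylog_functional_relation:
  assumes k: "k \<ge> 2" and z: "z \<in> D_plus \<inter> D_minus"
  shows "polylog k z + (\<Sum>j = 1..k - 1. (-1) ^ j * Ln z ^ j / fact j * polylog (k - j) z)
           + polylog_2_ones k (1 - z) = zeta_nat k"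
proof -
  \<comment> \<open>The left-hand side; \<open>Li\<^sub>k\<close> becomes the summand \<open>j = 0\<close> of the telescoping sum.\<close>
  define H where "H = (\<lambda>z. polylog k z + (\<Sum>j = 1..k - 1. (-1) ^ j * Ln z ^ j / fact j * polylog (k - j) z)
           + polylog_2_ones k (1 - z))"
  obtain m where m: "k = Suc m" "m \<ge> 1" using k by (cases k) auto
  have H: "H = (\<lambda>z. (\<Sum>j\<le>m. (-1) ^ j * Ln z ^ j / fact j * polylog (Suc m - j) z) + polylog_2_ones k (1 - z))"
    unfolding H_def m(1) atMost_atLeast0 by (subst sum.atLeast_Suc_atMost) auto
  have "(H has_field_derivative 0) (at z)" if z: "z \<in> D_plus \<inter> D_minus" for z
  proof -
    have "z \<noteq> 0" "z \<noteq> 1" "z \<in> D_minus" using z by (auto simp: D_plus_def D_minus_def)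
    from DERIV_add[OF polylog_relation_telescopes[OF z, of m m]
        polylog_2_ones_reflected_has_field_derivative[OF k this(3,2)]] \<open>z \<noteq> 0\<close>
    show ?thesis unfolding H by (simp add: m(1))
  qed
  moreover have "convex (D_plus \<inter> D_minus)"
    unfolding D_plus_def D_minus_def
    by (intro convex_Int convex_halfspace_Re_lt convex_halfspace_Re_gt)
  ultimately obtain C where C: "\<And>z. z \<in> D_plus \<inter> D_minus \<Longrightarrow> H z = C"
    using has_field_derivative_zero_constant[of "D_plus \<inter> D_minus" H]
    by (auto intro: has_field_derivative_at_within)
  have "((\<lambda>x::real. H (of_real x)) \<longlongrightarrow> zeta_nat k + (\<Sum>j = 1..k - 1. 0) + 0) (at_left 1)"
    unfolding H_def
  proof (intro tendsto_add tendsto_sum polylog_relation_terms_vanish polylog_tendsto_zeta[OF k])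
    have "isCont (polylog_2_ones k) 0"
      using polylog_2_ones_holomorphic(1)[OF k] zero_in_D_slit open_D_slit
      by (meson continuous_on_eq_continuous_at holomorphic_on_imp_continuous_on)
    then have "((\<lambda>x::real. polylog_2_ones k (1 - of_real x)) \<longlongrightarrow> polylog_2_ones k 0) (at_left 1)"
      by (rule isCont_tendsto_compose) (auto intro!: tendsto_eq_intros)
    then show "((\<lambda>x::real. polylog_2_ones k (1 - of_real x)) \<longlongrightarrow> 0) (at_left 1)"
      by (simp add: polylog_2_ones_holomorphic(2)[OF k])
  qed auto
  moreover have "((\<lambda>x::real. H (of_real x)) \<longlongrightarrow> C) (at_left 1)"
  proof (rule tendsto_eventually)
    have "\<forall>\<^sub>F x::real in at_left 1. x \<in> {0<..<1}" by (rule eventually_at_left_real) simp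
    then show "\<forall>\<^sub>F x::real in at_left 1. H (of_real x) = C"
      by eventually_elim (simp add: C D_plus_def D_minus_def)
  qed
  ultimately have "zeta_nat k + (\<Sum>j = 1..k - 1. 0) + 0 = C"
    by (intro tendsto_unique[of "at_left (1::real)"]) (auto simp: trivial_limit_at_left_real)
  then show ?thesis using C[OF z] by (simp add: H_def)
qed

section \<open>Uniqueness\<close>

text \<open>
  Gluing \<open>U\<close> and \<open>- V\<close> gives an entire function whose derivative tends to \<open>0\<close> at infinity, hence is
  \<open>0\<close> by Liouville's theorem. The value at \<open>0\<close>, a point of \<^term>\<open>D_plus\<close> only, rules out opposite
  constants.
\<close>

lemma additive_decomposition_unique:
  assumes U: "U holomorphic_on D_plus" and V: "V holomorphic_on D_minus"
    and eq: "\<And>z. z \<in> D_plus \<inter> D_minus \<Longrightarrow> U z + V z = 0"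
    and dU: "(deriv U \<longlongrightarrow> 0) (inf at_infinity (principal D_plus))"
    and dV: "(deriv V \<longlongrightarrow> 0) (inf at_infinity (principal D_minus))"
    and U0: "U 0 = 0"
  shows "\<And>z. z \<in> D_plus \<Longrightarrow> U z = 0" "\<And>z. z \<in> D_minus \<Longrightarrow> V z = 0"
proof -
  define G where "G = (\<lambda>z. if z \<in> D_plus then U z else - V z)"
  have GU: "G z = U z" if "z \<in> D_plus" for z using that by (simp add: G_def)
  have GV: "G z = - V z" if "z \<in> D_minus" for z
    using that eq[of z] by (auto simp: G_def eq_neg_iff_add_eq_0)
  have un: "D_plus \<union> D_minus = UNIV"
    by (auto simp: D_plus_def D_minus_def)
  have "G holomorphic_on D_plus" "G holomorphic_on D_minus"
    using U V holomorphic_on_minus[OF V]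
    by (simp_all add: GU GV cong: holomorphic_cong)
  then have G: "G holomorphic_on UNIV"
    using open_D_plus open_D_minus by (metis holomorphic_on_Un un)
  have dGU: "deriv G z = deriv U z" if "z \<in> D_plus" for z
    using that GU open_D_plus by (intro deriv_cong_ev eventually_nhds_in_open[THEN eventually_mono]) auto
  have dGV: "deriv G z = - deriv V z" if "z \<in> D_minus" for z
  proof -
    have "deriv G z = deriv (\<lambda>z. - V z) z"
      using that GV open_D_minus by (intro deriv_cong_ev eventually_nhds_in_open[THEN eventually_mono]) auto
    also have "\<dots> = - deriv V z"
      using holomorphic_on_imp_differentiable_at[OF V open_D_minus that] by simp
    finally show ?thesis .
  qed
  have "(deriv G \<longlongrightarrow> 0) (inf at_infinity (principal D_plus))"
    using dU by (rule Lim_transform_eventually)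
      (use eventually_in_set_and_large[of D_plus] in eventually_elim, simp add: dGU)
  moreover have "(deriv G \<longlongrightarrow> 0) (inf at_infinity (principal D_minus))"
  proof -
    have "((\<lambda>z. - deriv V z) \<longlongrightarrow> 0) (inf at_infinity (principal D_minus))"
      using tendsto_minus[OF dV] by simp
    then show ?thesis by (rule Lim_transform_eventually)
      (use eventually_in_set_and_large[of D_minus] in eventually_elim, simp add: dGV)
  qed
  ultimately have "(deriv G \<longlongrightarrow> 0) (sup (inf at_infinity (principal D_plus)) (inf at_infinity (principal D_minus)))"
    by (rule filterlim_sup)
  moreover have "sup (inf at_infinity (principal D_plus)) (inf at_infinity (principal D_minus)) = at_infinity"
    unfolding inf_sup_distrib1[symmetric] sup_principal un by simp
  ultimately have "(deriv G \<longlongrightarrow> 0) at_infinity" by simp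
  moreover have "deriv G holomorphic_on UNIV" using G by (simp add: holomorphic_deriv)
  ultimately have dG: "deriv G z = 0" for z by (intro Liouville_weak_0)
  obtain C where C: "\<And>z. G z = C"
    using has_field_derivative_zero_constant[of UNIV G] holomorphic_derivI[OF G, of _ UNIV] dG by auto
  have "G 0 = 0" using GU[of 0] U0 by (simp add: D_plus_def)
  then have G0: "G z = 0" for z using C by metis
  show "U z = 0" if "z \<in> D_plus" for z using GU[OF that] G0 by simp
  show "V z = 0" if "z \<in> D_minus" for z using GV[OF that] G0 by simp
qed

theorem theorem2:
  fixes f_plus f_minus :: "nat \<Rightarrow> complex \<Rightarrow> complex"
  assumes f1: "\<And>z. z \<in> D_plus \<Longrightarrow> f_plus 1 z = polylog 1 z"
    and hol_plus: "\<And>k. k \<ge> 2 \<Longrightarrow> f_plus k holomorphic_on D_plus"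
    and hol_minus: "\<And>k. k \<ge> 2 \<Longrightarrow> f_minus k holomorphic_on D_minus"
    and functional: "\<And>k z. k \<ge> 2 \<Longrightarrow> z \<in> D_plus \<inter> D_minus \<Longrightarrow>
      f_plus k z + (\<Sum>j = 1..k - 1. (-1) ^ j * Ln z ^ j / fact j * f_plus (k - j) z) + f_minus k z
        = zeta_nat k"
    and asymp_plus: "\<And>k. k \<ge> 2 \<Longrightarrow>
      (deriv (f_plus k) \<longlongrightarrow> 0) (inf at_infinity (principal D_plus))"
    and asymp_minus: "\<And>k. k \<ge> 2 \<Longrightarrow>
      (deriv (f_minus k) \<longlongrightarrow> 0) (inf at_infinity (principal D_minus))"
    and norm_plus: "\<And>k. k \<ge> 2 \<Longrightarrow> f_plus k 0 = 0"
  shows "\<forall>k\<ge>2. (\<forall>z\<in>D_plus. f_plus k z = polylog k z) \<and>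
                (\<forall>z\<in>D_minus. f_minus k z = polylog_2_ones k (1 - z))"
proof -
  have step: "(\<forall>z\<in>D_plus. f_plus k z = polylog k z) \<and> (\<forall>z\<in>D_minus. f_minus k z = polylog_2_ones k (1 - z))"
    if k: "k \<ge> 2" and IH: "\<And>i z. 1 \<le> i \<Longrightarrow> i < k \<Longrightarrow> z \<in> D_plus \<Longrightarrow> f_plus i z = polylog i z" for k
  proof -
    let ?P = "\<lambda>z. polylog_2_ones k (1 - z)"
    obtain m where m: "k = Suc m" using k by (cases k) auto
    have L: "polylog k holomorphic_on D_plus" "polylog k 0 = 0"
      using polylog_holomorphic[of m] holomorphic_on_subset[OF _ D_plus_subset_D_slit] by (auto simp: m)
    have P: "?P holomorphic_on D_minus"
      using holomorphic_on_compose_gen[OF _ polylog_2_ones_holomorphic(1)[OF k], of "\<lambda>z. 1 - z" D_minus]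
      by (simp add: o_def image_subset_iff one_minus_D_minus holomorphic_on_diff)
    define U where "U = (\<lambda>z. f_plus k z - polylog k z)"
    define V where "V = (\<lambda>z. f_minus k z - ?P z)"
    have U: "U holomorphic_on D_plus" and V: "V holomorphic_on D_minus"
      unfolding U_def V_def by (intro holomorphic_intros hol_plus hol_minus k L P)+
    have eq: "U z + V z = 0" if z: "z \<in> D_plus \<inter> D_minus" for z
    proof -
      have "(\<Sum>j = 1..k - 1. (-1) ^ j * Ln z ^ j / fact j * f_plus (k - j) z) =
            (\<Sum>j = 1..k - 1. (-1) ^ j * Ln z ^ j / fact j * polylog (k - j) z)"
        using z k by (intro sum.cong) (auto intro!: IH)
      with functional[OF k z] polylog_functional_relation[OF k z]
      have "(f_plus k z + S) + f_minus k z = (polylog k z + S) + ?P z"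
        if "S = (\<Sum>j = 1..k - 1. (-1) ^ j * Ln z ^ j / fact j * polylog (k - j) z)" for S
        by (simp only: that)
      then show ?thesis by (simp add: U_def V_def algebra_simps)
    qed
    have dU: "(deriv U \<longlongrightarrow> 0) (inf at_infinity (principal D_plus))"
    proof (rule Lim_transform_eventually)
      show "((\<lambda>z. deriv (f_plus k) z - deriv (polylog k) z) \<longlongrightarrow> 0) (inf at_infinity (principal D_plus))"
        using tendsto_diff[OF asymp_plus[OF k] deriv_polylog_tendsto_0[of m]] by (simp add: m)
      show "\<forall>\<^sub>F z in inf at_infinity (principal D_plus). deriv (f_plus k) z - deriv (polylog k) z = deriv U z"
        using eventually_in_set_and_large[of D_plus]
        by eventually_elim (auto simp: U_def intro!: deriv_diff[symmetric]
            holomorphic_on_imp_differentiable_at[OF _ open_D_plus] hol_plus k L)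
    qed
    have dV: "(deriv V \<longlongrightarrow> 0) (inf at_infinity (principal D_minus))"
    proof (rule Lim_transform_eventually)
      show "((\<lambda>z. deriv (f_minus k) z - deriv ?P z) \<longlongrightarrow> 0) (inf at_infinity (principal D_minus))"
        using tendsto_diff[OF asymp_minus[OF k] deriv_polylog_2_ones_tendsto_0[OF k]] by simp
      show "\<forall>\<^sub>F z in inf at_infinity (principal D_minus). deriv (f_minus k) z - deriv ?P z = deriv V z"
        using eventually_in_set_and_large[of D_minus]
        by eventually_elim (auto simp: V_def intro!: deriv_diff[symmetric]
            holomorphic_on_imp_differentiable_at[OF _ open_D_minus] hol_minus k P)
    qed
    have "U 0 = 0" by (simp add: U_def norm_plus[OF k] L)
    from additive_decomposition_unique[OF U V eq dU dV this] show ?thesis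
      by (auto simp: U_def V_def)
  qed
  have plus: "\<forall>z\<in>D_plus. f_plus k z = polylog k z" if "k \<ge> 1" for k
    using that
  proof (induction k rule: less_induct)
    case (less k)
    show ?case
    proof (cases "k = 1")
      case True
      then show ?thesis using f1 by simp
    next
      case False
      then show ?thesis using step[of k] less by auto
    qed
  qed
  show ?thesis using step plus by auto
qed

end
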